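(* Let $F$ be a finite field and let $B \subseteq F$ be a subfield such that $F$ has degree $t$ over $B$. Let $\mathcal{C} \subseteq F^n$ be an MDS code of dimension $k$ over $F$, and let $r$ be an integer with $1 \le r \le n-k$. Suppose that for every $I \subseteq [n]$ with $|I| = r$ there is a multiple-repair matrix $M \in F^{n \times rt}$ for $I$ with bandwidth at most $b$. Then $\mathcal{C}$ admits an exact centralized repair scheme for $r$ failures with bandwidth $b$ (measured in symbols of $B$).
   Context: Notation: $[n] = \{1,\ldots,n\}$. For $v,w \in F^n$, $\langle v,w\rangle = \sum_{i\in[n]} v_i w_i$. For a matrix $M$ with $n$ rows, $M[j,:]$ denotes its $j$-th row, and for $I \subseteq [n]$, $M[I,:]$ denotes the submatrix formed by the rows indexed by $I$. For a vector $v$, $\mathbf{set}(v)$ is the set of its entries. For $S \subseteq F$, $\mathrm{span}_B(S)$ is the $B$-linear span of $S$ in $F$ and $\dim_B$ is dimension over $B$. MDS code: an MDS code $\mathcal{C} \subseteq F^n$ of dimension $k \geq 1$ is an $F$-linear subspace of dimension $k$ such that any $k$ coordinates of a codeword $c\in\mathcal{C}$ determine $c$. The dual code is $\mathcal{C}^\perp = \{ v \in F^n : \langle c, v\rangle = 0 \text{ for all } c \in \mathcal{C}\}$. Multiple-repair matrix: for $I \subseteq [n]$ with $|I| = r$, a multiple-repair matrix with bandwidth $b$ for $I$ is a matrix $M \in F^{n \times rt}$ such that (1) the columns of $M$ are codewords of $\mathcal{C}^\perp$; (2) $M[I,:]$ has full rank over $B$, in the sense that $M[I,:]\cdot x \neq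 0$ for all nonzero $x \in B^{rt}$; (3) $\sum_{j \in [n]\setminus I} \dim_B \mathrm{span}_B(\mathbf{set}(M[j,:])) = b$. Exact centralized repair scheme: an exact centralized repair scheme for $r$ failures for $\mathcal{C} \subseteq F^n$ consists of, for each $I \subseteq [n]$ of size at most $r$, a collection of functions $\{ g_{I,j} : j \in [n]\setminus I\}$ with $g_{I,j} : F \to B^{b_{I,j}}$ for some non-negative integers $b_{I,j}$, such that for all $c \in \mathcal{C}$ and all $i \in I$, $c_i$ is determined by $\{ g_{I,j}(c_j) : j \in [n]\setminus I\}$. Its bandwidth (measured relative to $B$) is $\max_{I \subseteq [n], |I| \le r} \sum_{j \in [n]\setminus I} b_{I,j}$. *)

theory Defs
  imports
    "HOL-Analysis.Finite_Cartesian_Product"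
    "HOL-Analysis.Cartesian_Space"
    "HOL-Algebra.Embedded_Algebras"
    "HOL-Algebra.Algebraic_Closure_Type"
begin

text \<open>
  The field \<open>F\<close> is a type \<open>'a\<close> of classes \<open>field\<close> and \<open>finite\<close>, and \<open>F\<^sup>n\<close> is \<open>'a ^ 'n\<close>, so
  that the coordinate set \<open>[n]\<close> is \<open>UNIV :: 'n set\<close>. The subfield \<open>B\<close> is a subset of \<open>F\<close>, treated
  with the embedded-algebra theory of \<open>HOL-Algebra\<close>, applied to \<open>F\<close> as a ring record.
\<close>

abbreviation field_record :: "'a::field ring"
  where "field_record \<equiv> ring_of_type_algebra"

definition code_inner :: "'a::field ^ 'n::finite \<Rightarrow> 'a ^ 'n \<Rightarrow> 'a"
  where "code_inner v w = (\<Sum>i\<in>UNIV. v $ i * w $ i)"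

definition dual_code :: "('a::field ^ 'n::finite) set \<Rightarrow> ('a ^ 'n) set"
  where "dual_code C = {v. \<forall>c\<in>C. code_inner c v = 0}"

definition mds_code :: "nat \<Rightarrow> ('a::field ^ 'n::finite) set \<Rightarrow> bool"
  where "mds_code k C \<longleftrightarrow>
    1 \<le> k \<and> vec.subspace C \<and> vec.dim C = k \<and>
    (\<forall>K :: 'n set. card K = k \<longrightarrow>
      (\<forall>c\<in>C. \<forall>c'\<in>C. (\<forall>i\<in>K. c $ i = c' $ i) \<longrightarrow> c = c'))"

text \<open>
  The function \<open>ring.Span\<close> takes a list of generators and depends only on the set of its entries.
\<close>

definition span_dim :: "'a::field set \<Rightarrow> 'a list \<Rightarrow> nat"
  where "span_dim B xs = ring.dim field_record B (ring.Span field_record B xs)"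

text \<open>
  A matrix with rows indexed by \<open>'n\<close> and \<open>r * t\<close> columns is a function \<open>M :: 'n \<Rightarrow> nat \<Rightarrow> 'a\<close>, of
  which only the entries \<open>M j l\<close> with \<open>l < r * t\<close> matter; likewise for vectors of length \<open>r * t\<close>.
\<close>

definition multiple_repair_matrix ::
  "'a::field set \<Rightarrow> nat \<Rightarrow> ('a ^ 'n::finite) set \<Rightarrow> nat \<Rightarrow> 'n set \<Rightarrow> ('n \<Rightarrow> nat \<Rightarrow> 'a) \<Rightarrow> nat \<Rightarrow> bool"
  where "multiple_repair_matrix B t C r I M b \<longleftrightarrow>
    card I = r \<and>
    (\<forall>l<r * t. (\<chi> j. M j l) \<in> dual_code C) \<and>
    (\<forall>x :: nat \<Rightarrow> 'a. (\<forall>l<r * t. x l \<in> B) \<and> (\<exists>l<r * t. x l \<noteq> 0) \<longrightarrow>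
      (\<exists>i\<in>I. (\<Sum>l<r * t. M i l * x l) \<noteq> 0)) \<and>
    (\<Sum>j\<in>UNIV - I. span_dim B (map (M j) [0..<r * t])) = b"

text \<open>
  The integer \<open>bw I j\<close> is the number of symbols of \<open>B\<close> sent by node \<open>j\<close> when the nodes in \<open>I\<close>
  fail; elements of \<open>B\<^sup>m\<close> are lists of length \<open>m\<close> with entries in \<open>B\<close>.
\<close>

definition exact_centralized_repair_scheme ::
  "'a::field set \<Rightarrow> ('a ^ 'n::finite) set \<Rightarrow> nat \<Rightarrow>
    ('n set \<Rightarrow> 'n \<Rightarrow> nat) \<Rightarrow> ('n set \<Rightarrow> 'n \<Rightarrow> 'a \<Rightarrow> 'a list) \<Rightarrow> bool"
  where "exact_centralized_repair_scheme B C r bw g \<longleftrightarrow>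
    (\<forall>I :: 'n set. card I \<le> r \<longrightarrow>
      (\<forall>j\<in>UNIV - I. \<forall>x. length (g I j x) = bw I j \<and> set (g I j x) \<subseteq> B) \<and>
      (\<forall>i\<in>I. \<forall>c\<in>C. \<forall>c'\<in>C.
        (\<forall>j\<in>UNIV - I. g I j (c $ j) = g I j (c' $ j)) \<longrightarrow> c $ i = c' $ i))"

definition repair_bandwidth :: "nat \<Rightarrow> ('n::finite set \<Rightarrow> 'n \<Rightarrow> nat) \<Rightarrow> nat"
  where "repair_bandwidth r bw = Max ((\<lambda>I. \<Sum>j\<in>UNIV - I. bw I j) ` {I. card I \<le> r})"

end

theory Submission
  imports Defs
begin

text \<open>
  Fix a nonzero \<open>B\<close>-linear functional \<open>\<phi>\<close> on \<open>F\<close> (the trace, for instance). Node \<open>j\<close> sends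
  \<open>\<phi> (c\<^sub>j v)\<close> for \<open>v\<close> in a \<open>B\<close>-basis of the span of row \<open>j\<close> of \<open>M\<close>. If two codewords agree on
  these symbols, their difference \<open>d\<close> satisfies \<open>\<phi> (d\<^sub>j M\<^sub>j\<^sub>l) = 0\<close> for all \<open>j\<close> outside \<open>I\<close>, so
  orthogonality of \<open>d\<close> to the columns gives \<open>\<phi> (\<Sum>i\<in>I. d\<^sub>i M\<^sub>i\<^sub>l) = 0\<close> for every column \<open>l\<close>. The full
  rank condition and \<open>|F| = |B|\<^sup>t\<close> make the \<open>B\<close>-span of the columns of \<open>M[I,:]\<close> all of
  \<open>F\<^sup>r\<close>, so \<open>d\<close> vanishes on \<open>I\<close>. Fewer than \<open>r\<close> failures are treated by enlarging \<open>I\<close> to size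
  \<open>r\<close>, and the bandwidth is brought up to \<open>b\<close> by padding with zeros.
\<close>

section \<open>The field type viewed as a ring record\<close>

lemma field_record_simps [simp]:
  "carrier field_record = UNIV"
  "x \<otimes>\<^bsub>field_record\<^esub> y = x * y"
  "x \<oplus>\<^bsub>field_record\<^esub> y = x + y"
  "\<zero>\<^bsub>field_record\<^esub> = 0"
  "\<one>\<^bsub>field_record\<^esub> = 1"
  by (simp_all add: ring_of_type_algebra_def)

lemma ring_field_record: "ring (field_record :: 'a::field ring)"
  by (rule ring_from_type_algebra)

lemma field_record_minus [simp]: "\<ominus>\<^bsub>field_record\<^esub> x = - (x :: 'a::field)"
proof -
  interpret R: ring "field_record :: 'a ring" by (rule ring_field_record)
  show ?thesis
    using R.minus_equality[of "- x" x] by simp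
qed

section \<open>Subspaces and dimension over the subfield \<open>B\<close>\<close>

context
  fixes B :: "'a::field set"
  assumes B: "subfield B (field_record :: 'a ring)"
begin

lemma zero_mem_subfield: "0 \<in> B"
  using subringE(2)[OF subfieldE(1)[OF B]] by simp

lemma add_mem_subfield: "x \<in> B \<Longrightarrow> y \<in> B \<Longrightarrow> x + y \<in> B"
  using subringE(7)[OF subfieldE(1)[OF B], of x y] by simp

lemma mult_mem_subfield: "x \<in> B \<Longrightarrow> y \<in> B \<Longrightarrow> x * y \<in> B"
  using subringE(6)[OF subfieldE(1)[OF B], of x y] by simp

lemma diff_mem_subfield: "x \<in> B \<Longrightarrow> y \<in> B \<Longrightarrow> x - y \<in> B"
  using add_mem_subfield[of x "- y"] subringE(5)[OF subfieldE(1)[OF B], of y] by simp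

lemma line_extension_field_record_iff:
  "u \<in> ring.line_extension field_record B a E \<longleftrightarrow> (\<exists>k\<in>B. \<exists>v\<in>E. u = k * a + v)"
  using ring.line_extension_mem_iff[OF ring_field_record, of u B a E] by simp

lemma dimension_subspace:
  assumes "ring.dimension field_record n B E"
  shows "0 \<in> E"
    and "\<And>x y. x \<in> E \<Longrightarrow> y \<in> E \<Longrightarrow> x + y \<in> E"
    and "\<And>x y. x \<in> E \<Longrightarrow> y \<in> E \<Longrightarrow> x - y \<in> E"
    and "\<And>k x. k \<in> B \<Longrightarrow> x \<in> E \<Longrightarrow> k * x \<in> E"
    and "\<And>k x. k \<in> B \<Longrightarrow> k \<noteq> 0 \<Longrightarrow> k * x \<in> E \<Longrightarrow> x \<in> E"
proof -
  note props = ring.space_subgroup_props[OF ring_field_record B assms, simplified]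
  show "0 \<in> E"
    and add: "\<And>x y. x \<in> E \<Longrightarrow> y \<in> E \<Longrightarrow> x + y \<in> E"
    and "\<And>k x. k \<in> B \<Longrightarrow> x \<in> E \<Longrightarrow> k * x \<in> E"
    and "\<And>k x. k \<in> B \<Longrightarrow> k \<noteq> 0 \<Longrightarrow> k * x \<in> E \<Longrightarrow> x \<in> E"
    using props by blast+
  show "x - y \<in> E" if "x \<in> E" "y \<in> E" for x y
    using add[of x "- y"] props(4)[of y] that by simp
qed

text \<open>Subtracting the two representations puts \<open>(k - k') * v\<close> into
  \<open>E\<close>, and a nonzero scalar could be divided out to give \<open>v \<in> E\<close>. This
  serves twice: to count the elements of a line extension, and to make the coordinate along
  \<open>v\<close> well defined.\<close>

lemma line_extension_unique:
  assumes "ring.dimension field_record n B E" "v \<notin> E"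
    and "k \<in> B" "e \<in> E" "k' \<in> B" "e' \<in> E" "k * v + e = k' * v + e'"
  shows "k = k' \<and> e = e'"
proof -
  have "(k - k') * v = e' - e"
    using assms(7) by (simp add: algebra_simps)
  then have "(k - k') * v \<in> E"
    using dimension_subspace(3)[OF assms(1)] assms(4,6) by simp
  then have "k = k'"
    using dimension_subspace(5)[OF assms(1), of "k - k'" v] diff_mem_subfield assms(2,3,5) by auto
  then show ?thesis
    using assms(7) by simp
qed

text \<open>Starting from the zero space, each line extension multiplies the cardinality by
  \<open>card B\<close>, because its elements have unique representations.\<close>

lemma card_dimension:
  assumes "ring.dimension field_record n B E"
  shows "card E = card B ^ n"
  using assms
proof (induction n arbitrary: E)
  case 0
  then show ?case
    using ring.dimension_zero[OF ring_field_record B, of E] by simp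
next
  case (Suc n)
  obtain v E' where E': "ring.dimension field_record n B E'" and v: "v \<notin> E'"
    and E: "E = ring.line_extension field_record B v E'"
    using ring.dimension_backwards[OF ring_field_record B Suc.prems] by blast
  have "E = (\<lambda>(k, e). k * v + e) ` (B \<times> E')"
    unfolding E set_eq_iff line_extension_field_record_iff by fastforce
  moreover have "inj_on (\<lambda>(k, e). k * v + e) (B \<times> E')"
    using line_extension_unique[OF E' v] by (auto simp: inj_on_def)
  ultimately show ?case
    using Suc.IH[OF E'] by (simp add: card_image card_cartesian_product)
qed

section \<open>Linear functionals over \<open>B\<close> and the messages built from them\<close>

definition linear_functional :: "('a \<Rightarrow> 'a) \<Rightarrow> bool"
  where "linear_functional \<phi> \<longleftrightarrow> (\<forall>x. \<phi> x \<in> B) \<and> (\<forall>x y. \<phi> (x + y) = \<phi> x + \<phi> y) \<and>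
    (\<forall>k\<in>B. \<forall>x. \<phi> (k * x) = k * \<phi> x)"

lemma linear_functional_mem: "linear_functional \<phi> \<Longrightarrow> \<phi> x \<in> B"
  and linear_functional_add: "linear_functional \<phi> \<Longrightarrow> \<phi> (x + y) = \<phi> x + \<phi> y"
  and linear_functional_mult: "linear_functional \<phi> \<Longrightarrow> k \<in> B \<Longrightarrow> \<phi> (k * x) = k * \<phi> x"
  by (simp_all add: linear_functional_def)

lemma linear_functional_zero: "linear_functional \<phi> \<Longrightarrow> \<phi> 0 = 0"
  using linear_functional_mult[of \<phi> 0 0] zero_mem_subfield by simp

lemma linear_functional_diff: "linear_functional \<phi> \<Longrightarrow> \<phi> (x - y) = \<phi> x - \<phi> y"
  using linear_functional_add[of \<phi> "x - y" y] by simp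

lemma linear_functional_sum: "linear_functional \<phi> \<Longrightarrow> \<phi> (sum f A) = (\<Sum>a\<in>A. \<phi> (f a))"
  by (induction A rule: infinite_finite_induct)
    (simp_all add: linear_functional_zero linear_functional_add)

text \<open>The functional is the coordinate along a vector complementing a hyperplane.\<close>

lemma exists_nonzero_linear_functional:
  assumes "ring.dimension (field_record :: 'a ring) t B UNIV"
  obtains \<phi> u where "linear_functional \<phi>" "\<phi> u \<noteq> 0"
proof -
  have "t \<noteq> 0"
  proof
    assume "t = 0"
    then have "(UNIV :: 'a set) = {0}"
      using ring.dimension_zero[OF ring_field_record B, of UNIV] assms by simp
    then have "(1 :: 'a) \<in> {0}"
      by blast
    then show False
      by simp
  qed
  then obtain m where "t = Suc m"
    using not0_implies_Suc by blast
  then obtain v E where E: "ring.dimension field_record m B E" and v: "v \<notin> E"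
    and U: "UNIV = ring.line_extension field_record B v E"
    using ring.dimension_backwards[OF ring_field_record B] assms by blast
  note sub = dimension_subspace[OF E]
  have "\<exists>k\<in>B. x - k * v \<in> E" for x
  proof -
    have "x \<in> ring.line_extension field_record B v E"
      using U by blast
    then obtain k e where "k \<in> B" "e \<in> E" "x = k * v + e"
      by (auto simp: line_extension_field_record_iff)
    then show ?thesis
      by (intro bexI[of _ k]) simp_all
  qed
  then obtain \<phi> where \<phi>: "\<And>x. \<phi> x \<in> B" "\<And>x. x - \<phi> x * v \<in> E"
    by metis
  \<comment> \<open>As \<open>\<phi> x\<close> is the only scalar \<open>k\<close> in
    \<open>B\<close> with \<open>x - k * v \<in> E\<close>, each linearity law reduces to a
    membership in \<open>E\<close>.\<close>
  have eq: "\<phi> x = k" if "k \<in> B" "x - k * v \<in> E" for x k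
    using line_extension_unique[OF E v \<phi>(1)[of x] \<phi>(2)[of x] that] by simp
  have one: "1 \<in> B"
    using subringE(3)[OF subfieldE(1)[OF B]] by simp
  have "\<phi> (x + y) = \<phi> x + \<phi> y" for x y
  proof (rule eq)
    show "x + y - (\<phi> x + \<phi> y) * v \<in> E"
      using sub(2)[OF \<phi>(2)[of x] \<phi>(2)[of y]] by (simp add: algebra_simps)
  qed (simp add: \<phi> add_mem_subfield)
  moreover have "\<phi> (k * x) = k * \<phi> x" if "k \<in> B" for k x
  proof (rule eq)
    show "k * x - k * \<phi> x * v \<in> E"
      using sub(4)[OF that \<phi>(2)[of x]] by (simp add: algebra_simps)
  qed (simp add: \<phi> that mult_mem_subfield)
  ultimately have "linear_functional \<phi>"
    using \<phi>(1) by (simp add: linear_functional_def)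
  moreover have "\<phi> v = 1"
    using eq[OF one, of v] sub(1) by simp
  ultimately show ?thesis
    using that[of \<phi> v] by simp
qed

text \<open>For fixed \<open>d\<close>, the value \<open>\<phi> (d * w)\<close> is
  \<open>B\<close>-linear in \<open>w\<close>, so vanishing on the generators passes to their
  span.\<close>

lemma vanishes_on_Span:
  assumes \<phi>: "linear_functional \<phi>" and "\<forall>v\<in>set vs. \<phi> (d * v) = 0"
    and "w \<in> ring.Span field_record B vs"
  shows "\<phi> (d * w) = 0"
  using assms(2,3)
proof (induction vs arbitrary: w)
  case Nil
  then show ?case
    by (simp add: ring.Span.simps[OF ring_field_record] linear_functional_zero[OF \<phi>])
next
  case (Cons v vs)
  then obtain k e where "k \<in> B" "e \<in> ring.Span field_record B vs" "w = k * v + e"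
    by (auto simp: ring.Span.simps[OF ring_field_record] line_extension_field_record_iff)
  then have "d * w = k * (d * v) + d * e" and "\<phi> (d * e) = 0"
    using Cons.IH[of e] Cons.prems(1) by (simp_all add: distrib_left mult.left_commute)
  then show ?case
    using Cons.prems(1) \<open>k \<in> B\<close>
    by (simp add: linear_functional_add[OF \<phi>] linear_functional_mult[OF \<phi>])
qed

text \<open>Evaluating \<open>\<phi>\<close> only along a basis of the span of \<open>xs\<close>
  keeps the message as short as the dimension. Equal messages still make
  \<open>\<phi> ((x - y) * w)\<close> vanish on the whole span, hence at every entry of
  \<open>xs\<close>.\<close>

lemma exists_node_function:
  assumes \<phi>: "linear_functional \<phi>"
  obtains g where "\<And>x. length (g x) = span_dim B xs" "\<And>x. set (g x) \<subseteq> B"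
    "\<And>x y w. g x = g y \<Longrightarrow> w \<in> set xs \<Longrightarrow> \<phi> ((x - y) * w) = 0"
proof -
  let ?S = "ring.Span field_record B xs"
  have dim: "ring.dimension field_record (span_dim B xs) B ?S"
    using ring.finite_dimensionE[OF ring_field_record B]
      ring.Span_finite_dimension[OF ring_field_record B]
    by (simp add: span_dim_def over_def)
  obtain vs where vs: "length vs = span_dim B xs" "ring.Span field_record B vs = ?S"
    using ring.exists_base[OF ring_field_record B dim] by blast
  define g where "g x = map (\<lambda>v. \<phi> (x * v)) vs" for x
  show ?thesis
  proof (rule that[of g])
    show "\<phi> ((x - y) * w) = 0" if "g x = g y" "w \<in> set xs" for x y w
    proof (rule vanishes_on_Span[OF \<phi>])
      show "\<forall>v\<in>set vs. \<phi> ((x - y) * v) = 0"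
        using that(1) by (simp add: g_def left_diff_distrib linear_functional_diff[OF \<phi>])
      show "w \<in> ring.Span field_record B vs"
        using ring.Span_base_incl[OF ring_field_record B, of xs] that(2) vs(2) by auto
    qed
  qed (auto simp: g_def vs(1) linear_functional_mem[OF \<phi>])
qed

end

section \<open>Surjectivity by counting, and the repair of exactly \<open>r\<close> failures\<close>

lemma multiple_repair_matrix_columns_span:
  fixes B :: "'a::{field, finite} set" and C :: "('a ^ 'n::finite) set"
  assumes B: "subfield B (field_record :: 'a ring)"
    and dim: "ring.dimension (field_record :: 'a ring) t B UNIV"
    and M: "multiple_repair_matrix B t C r I M b"
  obtains x where "\<And>l. l < r * t \<Longrightarrow> x l \<in> B" "\<And>i. i \<in> I \<Longrightarrow> (\<Sum>l<r * t. M i l * x l) = y i"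
proof -
  \<comment> \<open>Extensional functions stand for the vectors: their values off the index set are
    fixed, so \<open>f\<close> can be injective on \<open>V\<close> and both sets have the expected
    finite cardinality.\<close>
  define V where "V = PiE {..<r * t} (\<lambda>_. B)"
  define W where "W = PiE I (\<lambda>_. UNIV :: 'a set)"
  define f where "f x = (\<lambda>i\<in>I. \<Sum>l<r * t. M i l * x l)" for x
  have full_rank: "\<exists>i\<in>I. (\<Sum>l<r * t. M i l * x l) \<noteq> 0"
    if "\<forall>l<r * t. x l \<in> B" "\<exists>l<r * t. x l \<noteq> 0" for x
    using M that by (simp add: multiple_repair_matrix_def)
  have "inj_on f V"
  proof (rule inj_onI)
    fix x x' assume mem: "x \<in> V" "x' \<in> V" and eq: "f x = f x'"
    have "(\<Sum>l<r * t. M i l * (x l - x' l)) = 0" if "i \<in> I" for i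
      using fun_cong[OF eq, of i] that by (simp add: f_def right_diff_distrib sum_subtractf)
    moreover have "\<forall>l<r * t. x l - x' l \<in> B"
      using mem by (auto simp: V_def intro: diff_mem_subfield[OF B])
    ultimately have "\<not> (\<exists>l<r * t. x l - x' l \<noteq> 0)"
      using full_rank[of "\<lambda>l. x l - x' l"] by blast
    then show "x = x'"
      using mem unfolding V_def by (intro PiE_ext) auto
  qed
  \<comment> \<open>Both sides equal \<open>card B ^ (r * t)\<close>, since the field has
    \<open>card B ^ t\<close> elements and \<open>I\<close> has \<open>r\<close>. Injectivity of
    \<open>f\<close> therefore gives surjectivity.\<close>
  moreover have "card V = card W"
    using card_dimension[OF B dim] M
    by (simp add: V_def W_def card_PiE multiple_repair_matrix_def flip: power_mult)
      (simp add: mult.commute)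
  moreover have "f ` V \<subseteq> W"
    by (auto simp: f_def W_def)
  moreover have "finite W"
    by (simp add: W_def finite_PiE)
  ultimately have "f ` V = W"
    by (simp add: card_image card_subset_eq)
  moreover have "restrict y I \<in> W"
    by (simp add: W_def)
  ultimately obtain x where x: "x \<in> V" "f x = restrict y I"
    by (metis imageE)
  show ?thesis
  proof (rule that[of x])
    show "(\<Sum>l<r * t. M i l * x l) = y i" if "i \<in> I" for i
      using fun_cong[OF x(2), of i] that by (simp add: f_def)
  qed (use x(1) in \<open>auto simp: V_def\<close>)
qed

lemma repair_from_matrix:
  fixes B :: "'a::{field, finite} set" and C :: "('a ^ 'n::finite) set"
  assumes B: "subfield B (field_record :: 'a ring)"
    and dim: "ring.dimension (field_record :: 'a ring) t B UNIV"
    and C: "vec.subspace C"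
    and M: "multiple_repair_matrix B t C r I M b"
  obtains g where "\<And>j x. length (g j x) = span_dim B (map (M j) [0..<r * t])"
    "\<And>j x. set (g j x) \<subseteq> B"
    "\<And>i c c'. i \<in> I \<Longrightarrow> c \<in> C \<Longrightarrow> c' \<in> C \<Longrightarrow> \<forall>j\<in>UNIV - I. g j (c $ j) = g j (c' $ j) \<Longrightarrow> c $ i = c' $ i"
proof -
  obtain \<phi> u where \<phi>: "linear_functional B \<phi>" and u: "\<phi> u \<noteq> 0"
    using exists_nonzero_linear_functional[OF B dim] .
  have "\<exists>h. (\<forall>x. length (h x) = span_dim B (map (M j) [0..<r * t])) \<and> (\<forall>x. set (h x) \<subseteq> B) \<and>
    (\<forall>x y l. h x = h y \<longrightarrow> l < r * t \<longrightarrow> \<phi> ((x - y) * M j l) = 0)" for j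
  proof -
    obtain h where "\<And>x. length (h x) = span_dim B (map (M j) [0..<r * t])" "\<And>x. set (h x) \<subseteq> B"
      "\<And>x y w. h x = h y \<Longrightarrow> w \<in> set (map (M j) [0..<r * t]) \<Longrightarrow> \<phi> ((x - y) * w) = 0"
      using exists_node_function[OF B \<phi>, of "map (M j) [0..<r * t]"] by blast
    then show ?thesis
      by (intro exI[of _ h]) auto
  qed
  then obtain g where len: "\<And>j x. length (g j x) = span_dim B (map (M j) [0..<r * t])"
    and mem: "\<And>j x. set (g j x) \<subseteq> B"
    and ker: "\<And>j x y l. g j x = g j y \<Longrightarrow> l < r * t \<Longrightarrow> \<phi> ((x - y) * M j l) = 0"
    by metis
  show ?thesis
  proof (rule that[of g])
    fix i c c'
    assume i: "i \<in> I" and "c \<in> C" "c' \<in> C" and eq: "\<forall>j\<in>UNIV - I. g j (c $ j) = g j (c' $ j)"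
    define d where "d = c - c'"
    have d: "d \<in> C"
      unfolding d_def using C \<open>c \<in> C\<close> \<open>c' \<in> C\<close> by (rule vec.subspace_diff)
    \<comment> \<open>Orthogonality to column \<open>l\<close> makes the sum over all nodes zero.
      The surviving nodes contribute a term killed by \<open>\<phi>\<close>, so the part over
      \<open>I\<close> is killed too.\<close>
    have col: "\<phi> (\<Sum>j\<in>I. d $ j * M j l) = 0" if l: "l < r * t" for l
    proof -
      have "(\<chi> j. M j l) \<in> dual_code C"
        using M l by (simp add: multiple_repair_matrix_def)
      then have "(\<Sum>j\<in>UNIV. d $ j * M j l) = 0"
        using d by (simp add: dual_code_def code_inner_def)
      moreover have "(\<Sum>j\<in>UNIV. d $ j * M j l) = (\<Sum>j\<in>UNIV - I. d $ j * M j l) + (\<Sum>j\<in>I. d $ j * M j l)"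
        by (intro sum.subset_diff) auto
      moreover have "\<phi> (\<Sum>j\<in>UNIV - I. d $ j * M j l) = 0"
        using ker[OF _ l] eq by (simp add: linear_functional_sum[OF B \<phi>] d_def)
      ultimately show ?thesis
        by (metis linear_functional_add[OF B \<phi>] linear_functional_zero[OF B \<phi>] add_0)
    qed
    show "c $ i = c' $ i"
    proof (rule ccontr)
      assume "c $ i \<noteq> c' $ i"
      then have di: "d $ i \<noteq> 0"
        by (simp add: d_def)
      \<comment> \<open>The target vector on \<open>I\<close> is supported at \<open>i\<close> and
        scaled so that its pairing with \<open>d\<close> is \<open>u\<close>.\<close>
      obtain x where x: "\<And>l. l < r * t \<Longrightarrow> x l \<in> B"
        and y: "\<And>j. j \<in> I \<Longrightarrow> (\<Sum>l<r * t. M j l * x l) = (if j = i then u / d $ i else 0)"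
        using multiple_repair_matrix_columns_span[OF B dim M, of "\<lambda>j. if j = i then u / d $ i else 0"] by blast
      have "u = (\<Sum>j\<in>I. d $ j * (if j = i then u / d $ i else 0))"
        using i di by (simp add: if_distrib cong: if_cong)
      also have "\<dots> = (\<Sum>j\<in>I. d $ j * (\<Sum>l<r * t. M j l * x l))"
        using y by simp
      \<comment> \<open>After swapping the sums, \<open>u\<close> is a \<open>B\<close>-combination
        of elements killed by \<open>\<phi>\<close>, contradicting
        \<open>\<phi> u \<noteq> 0\<close>.\<close>
      also have "\<dots> = (\<Sum>l<r * t. x l * (\<Sum>j\<in>I. d $ j * M j l))"
        unfolding sum_distrib_left by (subst sum.swap) (simp add: mult_ac)
      finally have "\<phi> u = (\<Sum>l<r * t. \<phi> (x l * (\<Sum>j\<in>I. d $ j * M j l)))"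
        by (simp only: linear_functional_sum[OF B \<phi>])
      also have "\<dots> = 0"
        using x col by (simp add: linear_functional_mult[OF B \<phi>])
      finally show False
        using u by simp
    qed
  qed (use len mem in auto)
qed

section \<open>All failure sets of size at most \<open>r\<close>, with bandwidth exactly
  \<open>b\<close>\<close>

theorem theorem1:
  fixes B :: "'a::{field, finite} set"
    and C :: "('a ^ 'n::finite) set"
    and k r t b :: nat
  assumes "subfield B (field_record :: 'a ring)"
    and "ring.dimension (field_record :: 'a ring) t B UNIV"
    and "mds_code k C"
    and "1 \<le> r" and "r \<le> CARD('n) - k"
    and "\<And>I :: 'n set. card I = r \<Longrightarrow>
           \<exists>M b'. multiple_repair_matrix B t C r I M b' \<and> b' \<le> b"
  shows "\<exists>bw g. exact_centralized_repair_scheme B C r bw g \<and> repair_bandwidth r bw = b"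
proof -
  have C: "vec.subspace C" and k: "1 \<le> k"
    using assms(3) by (simp_all add: mds_code_def)
  \<comment> \<open>The truncated subtraction is harmless: \<open>1 \<le> r\<close> makes the
    difference positive. At least one node thus lies outside any set of size
    \<open>r\<close>.\<close>
  have r: "r < CARD('n)"
    using assms(4,5) k by linarith
  have "\<exists>bw g. (\<Sum>j\<in>UNIV - I. bw j) = b \<and>
      (\<forall>j\<in>UNIV - I. \<forall>x. length (g j x) = bw j \<and> set (g j x) \<subseteq> B) \<and>
      (\<forall>i\<in>I. \<forall>c\<in>C. \<forall>c'\<in>C. (\<forall>j\<in>UNIV - I. g j (c $ j) = g j (c' $ j)) \<longrightarrow> c $ i = c' $ i)"
    if I: "card I \<le> r" for I :: "'n set"
  proof -
    obtain I' where I': "I \<subseteq> I'" "card I' = r"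
      using exists_subset_between[of I r UNIV] I r by auto
    obtain M b' where M: "multiple_repair_matrix B t C r I' M b'" and b': "b' \<le> b"
      using assms(6)[OF I'(2)] by blast
    obtain g where len: "\<And>j x. length (g j x) = span_dim B (map (M j) [0..<r * t])"
      and mem: "\<And>j x. set (g j x) \<subseteq> B"
      and det: "\<And>i c c'. i \<in> I' \<Longrightarrow> c \<in> C \<Longrightarrow> c' \<in> C \<Longrightarrow>
        \<forall>j\<in>UNIV - I'. g j (c $ j) = g j (c' $ j) \<Longrightarrow> c $ i = c' $ i"
      using repair_from_matrix[OF assms(1,2) C M] by metis
    obtain j0 where j0: "j0 \<notin> I'"
      using I'(2) r by (metis UNIV_eq_I less_irrefl)
    \<comment> \<open>One surviving node \<open>j0\<close> absorbs the whole slack, which makes the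
      total exactly \<open>b\<close> for every \<open>I\<close>.\<close>
    define pad where "pad j = (if j = j0 then b - b' else 0)" for j
    \<comment> \<open>Nodes in \<open>I' - I\<close> have not failed but stay silent. The appended
      zeros do not depend on \<open>x\<close>, so equal messages \<open>h\<close> give equal
      messages \<open>g\<close> outside \<open>I'\<close>.\<close>
    define h where "h j x = (if j \<in> I' then [] else g j x @ replicate (pad j) 0)" for j x
    define bw where "bw j = (if j \<in> I' then 0 else span_dim B (map (M j) [0..<r * t]) + pad j)" for j
    have "(\<Sum>j\<in>UNIV - I. bw j) = (\<Sum>j\<in>UNIV - I'. bw j)"
      using I'(1) by (intro sum.mono_neutral_right) (auto simp: bw_def)
    also have "\<dots> = (\<Sum>j\<in>UNIV - I'. span_dim B (map (M j) [0..<r * t])) + (\<Sum>j\<in>UNIV - I'. pad j)"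
      by (simp add: bw_def sum.distrib)
    also have "\<dots> = b' + (b - b')"
      using M j0 by (simp add: multiple_repair_matrix_def pad_def)
    finally have "(\<Sum>j\<in>UNIV - I. bw j) = b"
      using b' by simp
    moreover have "length (h j x) = bw j \<and> set (h j x) \<subseteq> B" for j x
      using mem[of j x] zero_mem_subfield[OF assms(1)] by (auto simp: h_def bw_def len)
    moreover have "c $ i = c' $ i"
      if "i \<in> I" "c \<in> C" "c' \<in> C" "\<forall>j\<in>UNIV - I. h j (c $ j) = h j (c' $ j)"
      for i and c c' :: "'a ^ 'n"
    proof (rule det)
      show "\<forall>j\<in>UNIV - I'. g j (c $ j) = g j (c' $ j)"
      proof
        fix j assume "j \<in> UNIV - I'"
        then show "g j (c $ j) = g j (c' $ j)"
          using bspec[OF that(4), of j] I'(1) by (auto simp: h_def)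
      qed
    qed (use that I'(1) in auto)
    ultimately show ?thesis
      by (intro exI[of _ bw] exI[of _ h]) blast
  qed
  then obtain bw g where sum: "\<And>I :: 'n set. card I \<le> r \<Longrightarrow> (\<Sum>j\<in>UNIV - I. bw I j) = b"
    and scheme: "\<And>I :: 'n set. card I \<le> r \<Longrightarrow>
      (\<forall>j\<in>UNIV - I. \<forall>x. length (g I j x) = bw I j \<and> set (g I j x) \<subseteq> B) \<and>
      (\<forall>i\<in>I. \<forall>c\<in>C. \<forall>c'\<in>C. (\<forall>j\<in>UNIV - I. g I j (c $ j) = g I j (c' $ j)) \<longrightarrow> c $ i = c' $ i)"
    by metis
  have "(\<lambda>I. \<Sum>j\<in>UNIV - I. bw I j) ` {I :: 'n set. card I \<le> r} = (\<lambda>I. b) ` {I :: 'n set. card I \<le> r}"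
    by (intro image_cong) (simp_all add: sum)
  also have "\<dots> = {b}"
    \<comment> \<open>The empty failure set witnesses that the maximum is over a nonempty
      family.\<close>
    by (rule image_constant[of "{}"]) simp
  finally have "repair_bandwidth r bw = b"
    by (simp add: repair_bandwidth_def)
  moreover have "exact_centralized_repair_scheme B C r bw g"
    unfolding exact_centralized_repair_scheme_def using scheme by blast
  ultimately show ?thesis
    by blast
qed

end
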